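(* Let $w\in\mathbb{R}^p$, $\rho>0$, $\eta>0$, and assume $g_r(w)\neq0$ and $q(w)\neq0$. For any $\beta\ge0$: (i) $g_r(w)^\top\bigl(\beta\,\delta_{\mathrm{rosu}}(w)\bigr)=0$, and consequently $$g_r(w)^\top\bigl(\beta\,\delta_{\mathrm{rosu}}(w)-\eta v\bigr)=-\eta\,g_r(w)^\top v.$$ (ii) $g_f(w)^\top\bigl(\beta\,\delta_{\mathrm{rosu}}(w)\bigr)=\beta\,\rho\,\|q(w)\|_2\ge0$, with strict inequality whenever $\beta>0$. (iii) Among all $\zeta\in\mathbb{R}^p$ with $\|\zeta\|_2\le\beta\rho$ and $g_r(w)^\top\zeta=0$, the vector $\beta\,\delta_{\mathrm{rosu}}(w)$ is the unique maximizer of $g_f(w)^\top\zeta$: $$\beta\,\delta_{\mathrm{rosu}}(w)=\arg\max_{\|\zeta\|_2\le\beta\rho,\;g_r(w)^\top\zeta=0}\;g_f(w)^\top\zeta.$$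
   Context: $L_f,L_r:\mathbb{R}^p\to\mathbb{R}$ are differentiable functions (forget and retain losses), with gradients $g_f=\nabla L_f$ and $g_r=\nabla L_r$. Put $$P_r(w)=\frac{g_r(w)g_r(w)^\top}{\|g_r(w)\|_2^2},\quad q(w)=(I-P_r(w))g_f(w),\quad P_\perp(w)=\frac{q(w)q(w)^\top}{\|q(w)\|_2^2},\quad \delta_{\mathrm{rosu}}(w)=\rho\,\frac{q(w)}{\|q(w)\|_2}.$$ The vector $v$ is $$v=\Bigl[I+\frac{\rho}{\|q(w)\|_2}\bigl(I-P_r(w)-P_\perp(w)\bigr)\Bigr]\nabla L_r\bigl(w+\delta_{\mathrm{rosu}}(w)\bigr),$$ and the complete update of the algorithm is $w\leftarrow w+\beta\,\delta_{\mathrm{rosu}}(w)-\eta v$. *)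

theory Defs
  imports "HOL-Analysis.Analysis"
begin

text \<open>The value is meaningful only where \<open>L\<close> is differentiable; see \<open>GDERIV_grad\<close>.\<close>

definition grad :: "(real ^ 'p \<Rightarrow> real) \<Rightarrow> real ^ 'p \<Rightarrow> real ^ 'p" where
  "grad L w = (THE g. GDERIV L w :> g)"

lemma GDERIV_imp_grad_eq:
  assumes "GDERIV L w :> g"
  shows "grad L w = g"
  unfolding grad_def
proof (rule the_equality, rule assms)
  fix h assume "GDERIV L w :> h"
  with assms have "(\<lambda>x. x \<bullet> h) = (\<lambda>x. x \<bullet> g)"
    unfolding gderiv_def by (rule has_derivative_unique[rotated])
  then show "h = g"
    by (metis vector_eq_rdot inner_commute)
qed

lemma GDERIV_grad:
  assumes "L differentiable (at w)"
  shows "GDERIV L w :> grad L w"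
proof -
  from assms obtain D where D: "(L has_derivative D) (at w)"
    unfolding differentiable_def by blast
  then have "linear D"
    by (rule has_derivative_linear)
  then have "D = (\<lambda>x. x \<bullet> adjoint D 1)"
    using adjoint_works[of D] by fastforce
  with D have "GDERIV L w :> adjoint D 1"
    unfolding gderiv_def by metis
  then show ?thesis
    using GDERIV_imp_grad_eq by metis
qed

definition outer :: "real ^ 'p \<Rightarrow> real ^ 'p \<Rightarrow> real ^ 'p ^ 'p" where
  "outer u v = (columnvector u :: real ^ 1 ^ 'p) ** (rowvector v :: real ^ 'p ^ 1)"

definition P_r :: "(real ^ 'p \<Rightarrow> real) \<Rightarrow> real ^ 'p \<Rightarrow> real ^ 'p ^ 'p" where
  "P_r L_r w = (1 / (norm (grad L_r w))\<^sup>2) *\<^sub>R outer (grad L_r w) (grad L_r w)"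

definition q :: "(real ^ 'p \<Rightarrow> real) \<Rightarrow> (real ^ 'p \<Rightarrow> real) \<Rightarrow> real ^ 'p \<Rightarrow> real ^ 'p" where
  "q L_f L_r w = (mat 1 - P_r L_r w) *v grad L_f w"

definition P_perp ::
  "(real ^ 'p \<Rightarrow> real) \<Rightarrow> (real ^ 'p \<Rightarrow> real) \<Rightarrow> real ^ 'p \<Rightarrow> real ^ 'p ^ 'p" where
  "P_perp L_f L_r w = (1 / (norm (q L_f L_r w))\<^sup>2) *\<^sub>R outer (q L_f L_r w) (q L_f L_r w)"

definition delta_rosu ::
  "(real ^ 'p \<Rightarrow> real) \<Rightarrow> (real ^ 'p \<Rightarrow> real) \<Rightarrow> real \<Rightarrow> real ^ 'p \<Rightarrow> real ^ 'p" where
  "delta_rosu L_f L_r \<rho> w = \<rho> *\<^sub>R ((1 / norm (q L_f L_r w)) *\<^sub>R q L_f L_r w)"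

definition v_rosu ::
  "(real ^ 'p \<Rightarrow> real) \<Rightarrow> (real ^ 'p \<Rightarrow> real) \<Rightarrow> real \<Rightarrow> real ^ 'p \<Rightarrow> real ^ 'p" where
  "v_rosu L_f L_r \<rho> w =
    (mat 1 + (\<rho> / norm (q L_f L_r w)) *\<^sub>R (mat 1 - P_r L_r w - P_perp L_f L_r w))
      *v grad L_r (w + delta_rosu L_f L_r \<rho> w)"

end

theory Submission
  imports Defs
begin

text \<open>On the hyperplane orthogonal to \<open>g\<^sub>r\<close> the functionals \<open>g\<^sub>f\<close> and \<open>q\<close> agree, because
  \<open>g\<^sub>f - q\<close> is a multiple of \<open>g\<^sub>r\<close>, and \<open>q\<close> itself lies in that hyperplane. Maximizing \<open>g\<^sub>f\<close> over
  the constraint set is therefore maximizing \<open>q\<close> over a ball, which the equality case of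
  Cauchy--Schwarz settles.\<close>

text \<open>Expanding the squared distance from \<open>z\<close> to the claimed point and inserting
  both bounds gives at most R^2 - 2 R^2 + R^2 = 0. The radius \<open>R = 0\<close> needs no separate
  treatment.\<close>

lemma inner_ball_maximizer_unique:
  fixes x z :: "'a::real_inner"
  assumes "x \<noteq> 0" "norm z \<le> R" "R * norm x \<le> x \<bullet> z"
  shows "z = (R / norm x) *\<^sub>R x"
proof -
  have R: "0 \<le> R"
    using norm_ge_zero assms(2) by (rule order_trans)
  have expand: "(norm (z - a *\<^sub>R x))\<^sup>2 = (norm z)\<^sup>2 - 2 * a * (x \<bullet> z) + (a * norm x)\<^sup>2" for a
    unfolding power_mult_distrib power2_norm_eq_inner
    by (simp add: inner_diff inner_commute power2_eq_square algebra_simps)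
  have "(norm (z - (R / norm x) *\<^sub>R x))\<^sup>2 = (norm z)\<^sup>2 - 2 * (R / norm x) * (x \<bullet> z) + R\<^sup>2"
    using expand[of "R / norm x"] assms(1) by simp
  \<comment> \<open>Since \<open>R\<close> is nonnegative, the coefficient of
    \<open>x \<bullet> z\<close> is nonpositive, so the lower bound on that inner product becomes an
    upper bound here.\<close>
  also have "\<dots> \<le> R\<^sup>2 - 2 * (R / norm x) * (R * norm x) + R\<^sup>2"
    using assms R by (intro add_mono diff_mono power_mono mult_left_mono) auto
  also have "\<dots> = 0"
    using assms(1) by (simp add: power2_eq_square)
  finally show ?thesis
    by simp
qed

lemma outer_vector_mult: "outer u v *v x = (v \<bullet> x) *\<^sub>R u"
  by (simp add: vec_eq_iff outer_def matrix_vector_mult_def matrix_matrix_mult_def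
      columnvector_def rowvector_def inner_vec_def sum_distrib_left sum_distrib_right ac_simps)

text \<open>This Gram-Schmidt form removes the matrices from the argument. When
  \<open>grad L_r w = 0\<close>, the convention 1 / 0 = 0 makes both sides
  \<open>grad L_f w\<close>.\<close>

lemma q_eq:
  "q L_f L_r w = grad L_f w - ((grad L_r w \<bullet> grad L_f w) / (norm (grad L_r w))\<^sup>2) *\<^sub>R grad L_r w"
  by (simp add: q_def P_r_def matrix_vector_mult_diff_rdistrib outer_vector_mult
      flip: scaleR_matrix_vector_assoc)

lemma grad_inner_q: "grad L_r w \<bullet> q L_f L_r w = 0"
  by (cases "grad L_r w = 0")
     (simp_all add: q_eq inner_diff_right power2_norm_eq_inner)

lemma inner_q_eq_inner_grad:
  assumes "grad L_r w \<bullet> \<zeta> = 0"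
  shows "q L_f L_r w \<bullet> \<zeta> = grad L_f w \<bullet> \<zeta>"
  using assms by (simp add: q_eq inner_diff_left)

theorem proposition7:
  fixes L_f L_r :: "real ^ 'p \<Rightarrow> real"
    and w :: "real ^ 'p"
    and \<rho> \<eta> \<beta> :: real
  assumes "\<And>x. L_f differentiable (at x)"
    and "\<And>x. L_r differentiable (at x)"
    and "\<rho> > 0"
    and "\<eta> > 0"
    and "grad L_r w \<noteq> 0"
    and "q L_f L_r w \<noteq> 0"
    and "\<beta> \<ge> 0"
  shows
    "(grad L_r w \<bullet> (\<beta> *\<^sub>R delta_rosu L_f L_r \<rho> w) = 0 \<and>
      grad L_r w \<bullet> (\<beta> *\<^sub>R delta_rosu L_f L_r \<rho> w - \<eta> *\<^sub>R v_rosu L_f L_r \<rho> w)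
        = - \<eta> * (grad L_r w \<bullet> v_rosu L_f L_r \<rho> w)) \<and>
     (grad L_f w \<bullet> (\<beta> *\<^sub>R delta_rosu L_f L_r \<rho> w) = \<beta> * \<rho> * norm (q L_f L_r w) \<and>
      \<beta> * \<rho> * norm (q L_f L_r w) \<ge> 0 \<and>
      (\<beta> > 0 \<longrightarrow> \<beta> * \<rho> * norm (q L_f L_r w) > 0)) \<and>
     {\<zeta>. is_arg_max (\<lambda>\<zeta>. grad L_f w \<bullet> \<zeta>)
            (\<lambda>\<zeta>. norm \<zeta> \<le> \<beta> * \<rho> \<and> grad L_r w \<bullet> \<zeta> = 0) \<zeta>}
       = {\<beta> *\<^sub>R delta_rosu L_f L_r \<rho> w}"
proof -
  let ?q = "q L_f L_r w" and ?d = "\<beta> *\<^sub>R delta_rosu L_f L_r \<rho> w"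
  have d: "?d = (\<beta> * \<rho> / norm ?q) *\<^sub>R ?q"
    by (simp add: delta_rosu_def)
  have orth: "grad L_r w \<bullet> ?d = 0"
    by (simp add: d grad_inner_q)
  \<comment> \<open>As \<open>?d\<close> is orthogonal to \<open>grad L_r w\<close>,
    \<open>grad L_f w\<close> may be replaced by \<open>?q\<close>; one factor
    \<open>norm ?q\<close> then cancels.\<close>
  have val: "grad L_f w \<bullet> ?d = \<beta> * \<rho> * norm ?q"
    using assms(6) inner_q_eq_inner_grad[OF orth, of L_f]
    by (simp add: d power2_eq_square flip: power2_norm_eq_inner)
  have norm_d: "norm ?d \<le> \<beta> * \<rho>"
    using assms(3,6,7) by (simp add: d)
  have upper: "grad L_f w \<bullet> \<zeta> \<le> \<beta> * \<rho> * norm ?q"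
    if "norm \<zeta> \<le> \<beta> * \<rho>" "grad L_r w \<bullet> \<zeta> = 0" for \<zeta>
  proof -
    have "?q \<bullet> \<zeta> \<le> norm ?q * norm \<zeta>"
      by (rule norm_cauchy_schwarz)
    also have "\<dots> \<le> norm ?q * (\<beta> * \<rho>)"
      using that(1) by (rule mult_left_mono) simp
    finally show ?thesis
      using inner_q_eq_inner_grad[OF that(2), of L_f] by (simp add: mult.commute)
  qed
  \<comment> \<open>The third premise says that the Cauchy-Schwarz bound \<open>upper\<close> is
    attained, which is the situation of \<open>inner_ball_maximizer_unique\<close> with
    \<open>x = ?q\<close> and \<open>R = \<beta> * \<rho>\<close>.\<close>
  have unique: "\<zeta> = ?d"
    if "norm \<zeta> \<le> \<beta> * \<rho>" "grad L_r w \<bullet> \<zeta> = 0" "\<beta> * \<rho> * norm ?q \<le> grad L_f w \<bullet> \<zeta>" for \<zeta>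
    unfolding d using that assms(6) inner_q_eq_inner_grad[OF that(2), of L_f]
    by (intro inner_ball_maximizer_unique) simp_all
  have "is_arg_max (\<lambda>\<zeta>. grad L_f w \<bullet> \<zeta>)
      (\<lambda>\<zeta>. norm \<zeta> \<le> \<beta> * \<rho> \<and> grad L_r w \<bullet> \<zeta> = 0) \<zeta> \<longleftrightarrow> \<zeta> = ?d" for \<zeta>
  proof
    assume "is_arg_max (\<lambda>\<zeta>. grad L_f w \<bullet> \<zeta>)
      (\<lambda>\<zeta>. norm \<zeta> \<le> \<beta> * \<rho> \<and> grad L_r w \<bullet> \<zeta> = 0) \<zeta>"
    \<comment> \<open>The feasible point \<open>?d\<close> serves as competitor: a maximizer does at
      least as well, and by \<open>val\<close> the value at \<open>?d\<close> is already the upper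
      bound.\<close>
    then have "norm \<zeta> \<le> \<beta> * \<rho>" "grad L_r w \<bullet> \<zeta> = 0" "grad L_f w \<bullet> ?d \<le> grad L_f w \<bullet> \<zeta>"
      using norm_d orth unfolding is_arg_max_linorder by blast+
    then show "\<zeta> = ?d"
      by (intro unique) (simp_all only: val)
  next
    assume "\<zeta> = ?d"
    then show "is_arg_max (\<lambda>\<zeta>. grad L_f w \<bullet> \<zeta>)
      (\<lambda>\<zeta>. norm \<zeta> \<le> \<beta> * \<rho> \<and> grad L_r w \<bullet> \<zeta> = 0) \<zeta>"
      using norm_d orth upper val unfolding is_arg_max_linorder by metis
  qed
  then have "{\<zeta>. is_arg_max (\<lambda>\<zeta>. grad L_f w \<bullet> \<zeta>)
      (\<lambda>\<zeta>. norm \<zeta> \<le> \<beta> * \<rho> \<and> grad L_r w \<bullet> \<zeta> = 0) \<zeta>} = {?d}"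
    by blast
  moreover have "grad L_r w \<bullet> (?d - \<eta> *\<^sub>R v_rosu L_f L_r \<rho> w)
      = - \<eta> * (grad L_r w \<bullet> v_rosu L_f L_r \<rho> w)"
    using orth by (simp add: inner_diff_right)
  ultimately show ?thesis
    using orth val assms(3,6,7) by simp
qed

end
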